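(* Let $\varphi\colon X\to X$ be a local homeomorphism of a compact Hausdorff space $X$ such that $|\varphi^{-1}(x)|=N>1$ for all $x\in X$. Then there exist pairwise disjoint open subsets $U_1,\dots,U_N$ of $X$ such that (1) $\varphi|_{U_i}$ is one-to-one for all $i=1,\dots,N$; (2) $\varphi(U_i)=\varphi(U_j)$ for all $i,j=1,\dots,N$; (3) $X=\bigcup_{i=1}^N(U_i\cup\partial U_i)$; (4) $X=\varphi(U_i)\cup\partial\varphi(U_i)$ for all $i=1,\dots,N$. Moreover, $\varphi(\partial U_i)\subseteq\partial\varphi(U_i)$ and $\varphi^{-1}(\partial\varphi(U_i))=\bigcup_{j=1}^N\partial U_j$ for all $i=1,\dots,N$.
   Context: A map $\varphi\colon X\to X$ is a local homeomorphism if every point $x\in X$ has a neighborhood $U$ such that $\varphi|_U$ is a homeomorphism onto its image; local homeomorphisms are taken to be continuous and open. $N$ is a fixed finite integer, independent of $x$. $\partial U$ denotes the topological boundary of $U$ in $X$. *)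

theory Defs
  imports "HOL-Analysis.Analysis"
begin

(* Neighborhoods are not required to be open.  Continuity and openness are part of the
   definition, as local homeomorphisms are taken to be continuous and open. *)
definition local_homeomorphism_map ::
  "'a topology \<Rightarrow> 'b topology \<Rightarrow> ('a \<Rightarrow> 'b) \<Rightarrow> bool" where
  "local_homeomorphism_map X Y f \<longleftrightarrow>
     continuous_map X Y f \<and> open_map X Y f \<and>
     (\<forall>x \<in> topspace X. \<exists>U V. openin X V \<and> x \<in> V \<and> V \<subseteq> U \<and> U \<subseteq> topspace X \<and>
        homeomorphic_map (subtopology X U) (subtopology Y (f ` U)) f)"

end

theory Submission
  imports Defs
begin

text \<open>
  Over a small open set the map \<open>\<phi>\<close> looks like \<open>N\<close> disjoint copies of that set: separate the \<open>N\<close>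
  points of one fibre by disjoint open sets on which \<open>\<phi>\<close> is injective, and cut these sets down to
  a common image \<open>V\<close>.  A fibre over a point of \<open>V\<close> has \<open>N\<close> points and meets each of the \<open>N\<close>
  disjoint sets, so no point of it is missed (\<open>sheet_system_exhausts_fibre\<close>).  It remains to glue
  such local systems of sheets over an open \<^emph>\<open>dense\<close> set.  No compatibility has to be checked
  when two systems lie over disjoint open sets, and systems are closed under unions of chains,
  so Zorn's lemma gives a maximal system.  Its base is dense, for otherwise a system over a
  small open set that misses the base could be added (\<open>sheet_system_with_dense_base_exists\<close>).

  Let \<open>U\<^sub>1, \<dots>, U\<^sub>N\<close> be the sheets of a maximal system and \<open>W\<close> their common image.  The boundary
  of \<open>W\<close> is its complement, since \<open>W\<close> is open and dense.  The preimage of \<open>W\<close> is the union of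
  the \<open>U\<^sub>i\<close>, and it is dense because \<open>\<phi>\<close> is open.  Therefore the closures of the \<open>U\<^sub>i\<close> cover the
  space.  A boundary point of \<open>U\<^sub>i\<close> lies neither in \<open>U\<^sub>i\<close>, which is open, nor in another \<open>U\<^sub>j\<close>,
  which is an open set disjoint from \<open>U\<^sub>i\<close>; thus the boundaries of the \<open>U\<^sub>i\<close> fill out exactly the
  complement of their union, which is the preimage of the boundary of \<open>W\<close>.
\<close>

section \<open>Systems of sheets\<close>

text \<open>
  A family of sheets is encoded as one set of labelled points, the sheet with label \<open>i\<close> being
  \<open>P `` {i}\<close>.  With this encoding enlarging every sheet is set inclusion, and taking the union
  of the sheets label by label is plain union, which is what Zorn's lemma for
  inclusion asks for.  The last condition says that all sheets have the same image.
\<close>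
definition sheet_system :: "'a topology \<Rightarrow> ('a \<Rightarrow> 'b) \<Rightarrow> 'i set \<Rightarrow> ('i \<times> 'a) set \<Rightarrow> bool" where
  "sheet_system X f I P \<longleftrightarrow>
     P \<subseteq> I \<times> topspace X \<and>
     (\<forall>i\<in>I. openin X (P `` {i})) \<and>
     (\<forall>i j y. (i, y) \<in> P \<longrightarrow> (j, y) \<in> P \<longrightarrow> i = j) \<and>
     (\<forall>i y z. (i, y) \<in> P \<longrightarrow> (i, z) \<in> P \<longrightarrow> f y = f z \<longrightarrow> y = z) \<and>
     (\<forall>i j y. (i, y) \<in> P \<longrightarrow> j \<in> I \<longrightarrow> (\<exists>z. (j, z) \<in> P \<and> f z = f y))"

definition sheet_base :: "('a \<Rightarrow> 'b) \<Rightarrow> ('i \<times> 'a) set \<Rightarrow> 'b set" where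
  "sheet_base f P = f ` snd ` P"

lemma sheet_systemD:
  assumes "sheet_system X f I P"
  shows "(i, y) \<in> P \<Longrightarrow> i \<in> I" "(i, y) \<in> P \<Longrightarrow> y \<in> topspace X"
    and "i \<in> I \<Longrightarrow> openin X (P `` {i})"
    and "(i, y) \<in> P \<Longrightarrow> (j, y) \<in> P \<Longrightarrow> i = j"
    and "(i, y) \<in> P \<Longrightarrow> (i, z) \<in> P \<Longrightarrow> f y = f z \<Longrightarrow> y = z"
    and "(i, y) \<in> P \<Longrightarrow> j \<in> I \<Longrightarrow> \<exists>z. (j, z) \<in> P \<and> f z = f y"
proof -
  have *: "P \<subseteq> I \<times> topspace X" "\<forall>i\<in>I. openin X (P `` {i})"
    "\<forall>i j y. (i, y) \<in> P \<longrightarrow> (j, y) \<in> P \<longrightarrow> i = j"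
    "\<forall>i y z. (i, y) \<in> P \<longrightarrow> (i, z) \<in> P \<longrightarrow> f y = f z \<longrightarrow> y = z"
    "\<forall>i j y. (i, y) \<in> P \<longrightarrow> j \<in> I \<longrightarrow> (\<exists>z. (j, z) \<in> P \<and> f z = f y)"
    using assms[unfolded sheet_system_def] by - ((elim conjE, assumption)+)
  show "(i, y) \<in> P \<Longrightarrow> i \<in> I" "(i, y) \<in> P \<Longrightarrow> y \<in> topspace X"
    using *(1) by auto
  show "i \<in> I \<Longrightarrow> openin X (P `` {i})"
    using *(2) by simp
  show "(i, y) \<in> P \<Longrightarrow> (j, y) \<in> P \<Longrightarrow> i = j"
    using *(3) by simp
  show "(i, y) \<in> P \<Longrightarrow> (i, z) \<in> P \<Longrightarrow> f y = f z \<Longrightarrow> y = z"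
    using *(4) by simp
  show "(i, y) \<in> P \<Longrightarrow> j \<in> I \<Longrightarrow> \<exists>z. (j, z) \<in> P \<and> f z = f y"
    using *(5) by simp
qed

lemma sheet_base_iff: "w \<in> sheet_base f P \<longleftrightarrow> (\<exists>i y. (i, y) \<in> P \<and> w = f y)"
  unfolding sheet_base_def by force

lemma image_sheet_eq_base:
  assumes "sheet_system X f I P" "i \<in> I"
  shows "f ` (P `` {i}) = sheet_base f P"
proof
  show "f ` (P `` {i}) \<subseteq> sheet_base f P"
    by (force simp: sheet_base_def)
  show "sheet_base f P \<subseteq> f ` (P `` {i})"
  proof
    fix w assume "w \<in> sheet_base f P"
    then obtain j y where "(j, y) \<in> P" "w = f y"
      by (auto simp: sheet_base_iff)
    then obtain z where "(i, z) \<in> P" "f z = w"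
      using sheet_systemD(6)[OF assms(1) _ assms(2)] by metis
    then show "w \<in> f ` (P `` {i})"
      by auto
  qed
qed

text \<open>
  Picking the point over \<open>f y\<close> in each sheet gives an injection of the labels into the fibre
  through \<open>y\<close>; since both have the same finite cardinality, it hits \<open>y\<close>.
\<close>
lemma sheet_system_exhausts_fibre:
  assumes P: "sheet_system X f I P" and "finite I"
    and "card {z \<in> topspace X. f z = f y} = card I"
    and y: "y \<in> topspace X" and "f y \<in> sheet_base f P"
  shows "\<exists>i\<in>I. (i, y) \<in> P"
proof -
  let ?F = "{z \<in> topspace X. f z = f y}"
  obtain k x where kx: "(k, x) \<in> P" "f y = f x"
    using assms(5) by (auto simp: sheet_base_iff)
  have "\<forall>j\<in>I. \<exists>z. (j, z) \<in> P \<and> f z = f y"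
    using sheet_systemD(6)[OF P kx(1)] kx(2) by auto
  then obtain g where g: "\<And>j. j \<in> I \<Longrightarrow> (j, g j) \<in> P \<and> f (g j) = f y"
    by metis
  have "inj_on g I"
    by (rule inj_onI) (metis g sheet_systemD(4)[OF P])
  then have "card (g ` I) = card ?F"
    using assms(3) by (simp add: card_image)
  moreover have "g ` I \<subseteq> ?F"
    using g sheet_systemD(2)[OF P] by auto
  moreover have "finite ?F"
  proof (rule card_ge_0_finite)
    show "card ?F > 0"
      using assms(2,3) sheet_systemD(1)[OF P kx(1)] by (auto simp: card_gt_0_iff)
  qed
  ultimately have "g ` I = ?F"
    by (metis card_subset_eq)
  then have "y \<in> g ` I"
    using y by simp
  then show ?thesis
    using g by auto
qed

text \<open>
  Points of the two systems never lie in a common fibre, so injectivity on the sheets and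
  disjointness of differently labelled sheets are inherited.
\<close>
lemma sheet_system_Un:
  assumes P: "sheet_system X f I P" and Q: "sheet_system X f I Q"
    and disj: "sheet_base f P \<inter> sheet_base f Q = {}"
  shows "sheet_system X f I (P \<union> Q)"
proof -
  have ne: "f y \<noteq> f z" if "(i, y) \<in> P" "(j, z) \<in> Q" for i j y z
    using that disj by (metis disjoint_iff sheet_base_iff)
  have "openin X ((P \<union> Q) `` {i})" if "i \<in> I" for i
    using sheet_systemD(3)[OF P that] sheet_systemD(3)[OF Q that] by (simp add: Un_Image openin_Un)
  moreover have "i = j" if "(i, y) \<in> P \<union> Q" "(j, y) \<in> P \<union> Q" for i j y
    using that ne sheet_systemD(4)[OF P] sheet_systemD(4)[OF Q] by blast
  moreover have "y = z" if "(i, y) \<in> P \<union> Q" "(i, z) \<in> P \<union> Q" "f y = f z" for i y z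
    using that ne sheet_systemD(5)[OF P] sheet_systemD(5)[OF Q] by (metis Un_iff)
  moreover have "\<exists>z. (j, z) \<in> P \<union> Q \<and> f z = f y" if "(i, y) \<in> P \<union> Q" "j \<in> I" for i j y
    using that sheet_systemD(6)[OF P] sheet_systemD(6)[OF Q] by (metis Un_iff)
  moreover have "P \<union> Q \<subseteq> I \<times> topspace X"
    using sheet_systemD(1,2)[OF P] sheet_systemD(1,2)[OF Q] by auto
  ultimately show ?thesis
    unfolding sheet_system_def by (intro conjI ballI allI impI)
qed

lemma sheet_system_Union_chain:
  assumes chain: "subset.chain {P. sheet_system X f I P} \<C>"
  shows "sheet_system X f I (\<Union>\<C>)"
proof -
  have C: "sheet_system X f I P" if "P \<in> \<C>" for P
    using that chain by (auto simp: subset_chain_def)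
  \<comment> \<open>Two points of the union already lie in one member of the chain.\<close>
  have two: "\<exists>P\<in>\<C>. p \<in> P \<and> q \<in> P" if pq: "p \<in> \<Union>\<C>" "q \<in> \<Union>\<C>" for p q
  proof -
    obtain A B where AB: "A \<in> \<C>" "B \<in> \<C>" "p \<in> A" "q \<in> B"
      using pq by auto
    then have "A \<subseteq> B \<or> B \<subseteq> A"
      using chain by (simp add: subset_chain_def)
    then show ?thesis
      using AB by auto
  qed
  have "openin X (\<Union>\<C> `` {i})" if "i \<in> I" for i
  proof -
    have "\<Union>\<C> `` {i} = (\<Union>P\<in>\<C>. P `` {i})"
      by blast
    then show ?thesis
      using sheet_systemD(3)[OF C that] by (auto intro!: openin_Union)
  qed
  moreover have "i = j" if ij: "(i, y) \<in> \<Union>\<C>" "(j, y) \<in> \<Union>\<C>" for i j y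
  proof -
    obtain P where "P \<in> \<C>" "(i, y) \<in> P" "(j, y) \<in> P"
      using two[OF ij] by auto
    then show ?thesis
      by (rule sheet_systemD(4)[OF C])
  qed
  moreover have "y = z" if yz: "(i, y) \<in> \<Union>\<C>" "(i, z) \<in> \<Union>\<C>" "f y = f z" for i y z
  proof -
    obtain P where "P \<in> \<C>" "(i, y) \<in> P" "(i, z) \<in> P"
      using two[OF yz(1,2)] by auto
    then show ?thesis
      using yz(3) by (rule sheet_systemD(5)[OF C])
  qed
  moreover have "\<exists>z. (j, z) \<in> \<Union>\<C> \<and> f z = f y" if iy: "(i, y) \<in> \<Union>\<C>" and j: "j \<in> I" for i j y
  proof -
    obtain P where P: "P \<in> \<C>" "(i, y) \<in> P"
      using iy by auto
    then obtain z where "(j, z) \<in> P" "f z = f y"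
      using sheet_systemD(6)[OF C[OF P(1)] P(2) j] by auto
    then show ?thesis
      using P(1) by auto
  qed
  moreover have "\<Union>\<C> \<subseteq> I \<times> topspace X"
  proof
    fix p assume "p \<in> \<Union>\<C>"
    then obtain P where "P \<in> \<C>" "p \<in> P"
      by auto
    then show "p \<in> I \<times> topspace X"
      using sheet_systemD(1,2)[OF C, of P "fst p" "snd p"] by (simp add: mem_Times_iff)
  qed
  ultimately show ?thesis
    unfolding sheet_system_def by (intro conjI ballI allI impI)
qed

section \<open>Local homeomorphisms with finite fibres\<close>

lemma Hausdorff_space_separate_finite_family:
  assumes "Hausdorff_space X" "finite I" "inj_on y I" "y ` I \<subseteq> topspace X"
  obtains V where "\<And>i. i \<in> I \<Longrightarrow> openin X (V i)" "\<And>i. i \<in> I \<Longrightarrow> y i \<in> V i"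
    "disjoint_family_on V I"
proof -
  have "\<forall>i\<in>I. \<forall>j\<in>I - {i}. \<exists>G H. openin X G \<and> openin X H \<and> y i \<in> G \<and> y j \<in> H \<and> disjnt G H"
    using assms unfolding Hausdorff_space_def inj_on_def by (metis Diff_iff image_subset_iff singletonI)
  \<comment> \<open>The choice for \<open>(i, j)\<close> is unrelated to the one for \<open>(j, i)\<close>, so each \<open>V i\<close> uses both.\<close>
  then obtain G H where GH: "\<And>i j. i \<in> I \<Longrightarrow> j \<in> I - {i} \<Longrightarrow>
      openin X (G i j) \<and> openin X (H i j) \<and> y i \<in> G i j \<and> y j \<in> H i j \<and> disjnt (G i j) (H i j)"
    by metis
  define V where "V i = (\<Inter>j\<in>I - {i}. G i j \<inter> H j i) \<inter> topspace X" for i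
  show thesis
  proof
    show "openin X (V i)" if "i \<in> I" for i
      unfolding V_def using assms(2) that GH by (intro openin_INT) auto
    show "y i \<in> V i" if "i \<in> I" for i
      unfolding V_def using assms(4) that GH by auto
    show "disjoint_family_on V I"
      unfolding disjoint_family_on_def
    proof (intro ballI impI)
      fix i j assume ij: "i \<in> I" "j \<in> I" "i \<noteq> j"
      then have "V i \<subseteq> G i j" "V j \<subseteq> H i j"
        by (auto simp: V_def)
      then show "V i \<inter> V j = {}"
        using GH[of i j] ij by (auto simp: disjnt_iff)
    qed
  qed
qed

lemma local_homeomorphism_map_locally_inj:
  assumes "local_homeomorphism_map X Y f" "x \<in> topspace X"
  shows "\<exists>V. openin X V \<and> x \<in> V \<and> inj_on f V"
proof -
  obtain U V where UV: "openin X V" "x \<in> V" "V \<subseteq> U" "U \<subseteq> topspace X"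
    "homeomorphic_map (subtopology X U) (subtopology Y (f ` U)) f"
    using assms unfolding local_homeomorphism_map_def by blast
  have "inj_on f U"
    using homeomorphic_imp_injective_map[OF UV(5)] UV(4) by (simp add: Int_absorb1)
  then show ?thesis
    using UV(1-3) inj_on_subset by blast
qed

text \<open>
  Separate the fibre over \<open>w\<close> by disjoint open sets on which \<open>f\<close> is injective.  Their images are
  open and there are finitely many of them, so those images have a common open part \<open>V\<close> inside
  the given neighbourhood of \<open>w\<close>; the sheets are the parts of the chosen sets that lie over \<open>V\<close>.
\<close>
lemma small_sheet_system_exists:
  assumes f: "local_homeomorphism_map X Y f" and "Hausdorff_space X"
    and "finite I" "I \<noteq> {}" and card: "card {y \<in> topspace X. f y = w} = card I"
    and O: "openin Y O'" "w \<in> O'"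
  shows "\<exists>Q. sheet_system X f I Q \<and> w \<in> sheet_base f Q \<and> sheet_base f Q \<subseteq> O'"
proof -
  have cont: "continuous_map X Y f" and opn: "open_map X Y f"
    using f by (auto simp: local_homeomorphism_map_def)
  let ?F = "{y \<in> topspace X. f y = w}"
  have "finite ?F"
    using card \<open>finite I\<close> \<open>I \<noteq> {}\<close> by (intro card_ge_0_finite) (simp add: card_gt_0_iff)
  then obtain y where y: "bij_betw y I ?F"
    using card \<open>finite I\<close> by (metis finite_same_card_bij)
  then have yF: "\<And>i. i \<in> I \<Longrightarrow> y i \<in> topspace X \<and> f (y i) = w"
    by (auto simp: bij_betw_def)
  obtain A where A: "\<And>i. i \<in> I \<Longrightarrow> openin X (A i)" "\<And>i. i \<in> I \<Longrightarrow> y i \<in> A i"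
    "disjoint_family_on A I"
  proof -
    have "inj_on y I" "y ` I \<subseteq> topspace X"
      using y yF by (auto simp: bij_betw_def)
    from Hausdorff_space_separate_finite_family[OF \<open>Hausdorff_space X\<close> \<open>finite I\<close> this]
    show ?thesis
      using that by metis
  qed
  have "\<forall>i\<in>I. \<exists>B. openin X B \<and> y i \<in> B \<and> inj_on f B"
    using local_homeomorphism_map_locally_inj[OF f] yF by blast
  then obtain B where B: "\<And>i. i \<in> I \<Longrightarrow> openin X (B i) \<and> y i \<in> B i \<and> inj_on f (B i)"
    by metis
  define V where "V = O' \<inter> ((\<Inter>i\<in>I. f ` (A i \<inter> B i)) \<inter> topspace Y)"
  have "openin Y V"
    unfolding V_def
  proof (rule openin_Int[OF O(1) openin_INT[OF \<open>finite I\<close>]])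
    fix i assume "i \<in> I"
    then show "openin Y (f ` (A i \<inter> B i))"
      using opn A(1) B by (simp add: open_map_def openin_Int)
  qed
  have "w \<in> f ` (A i \<inter> B i)" if "i \<in> I" for i
    using yF[OF that] A(2)[OF that] B[OF that] by (intro image_eqI[of _ _ "y i"]) auto
  then have "w \<in> V"
    using O(2) openin_subset[OF O(1)] by (auto simp: V_def)
  define Q where "Q = {(i, z). i \<in> I \<and> z \<in> A i \<inter> B i \<and> f z \<in> V}"
  have lift: "\<exists>z. (i, z) \<in> Q \<and> f z = v" if "i \<in> I" "v \<in> V" for i v
  proof -
    have "v \<in> f ` (A i \<inter> B i)"
      using that by (simp add: V_def)
    then obtain z where "z \<in> A i \<inter> B i" "v = f z"
      by (rule imageE)
    then show ?thesis
      using that by (intro exI[of _ z]) (simp add: Q_def)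
  qed
  have base: "sheet_base f Q = V"
  proof
    show "sheet_base f Q \<subseteq> V"
      by (auto simp: sheet_base_iff Q_def)
    show "V \<subseteq> sheet_base f Q"
    proof
      fix v assume "v \<in> V"
      moreover obtain i where "i \<in> I"
        using \<open>I \<noteq> {}\<close> by auto
      ultimately obtain z where "(i, z) \<in> Q" "f z = v"
        using lift by metis
      then show "v \<in> sheet_base f Q"
        by (auto simp: sheet_base_iff)
    qed
  qed
  have "sheet_system X f I Q"
    unfolding sheet_system_def
  proof (intro conjI ballI allI impI)
    show "Q \<subseteq> I \<times> topspace X"
      using A(1) by (auto simp: Q_def dest: openin_subset)
    show "openin X (Q `` {i})" if i: "i \<in> I" for i
    proof -
      have "Q `` {i} = (A i \<inter> B i) \<inter> {x \<in> topspace X. f x \<in> V}"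
        using i openin_subset[OF A(1)[OF i]] by (auto simp: Q_def)
      then show ?thesis
        using openin_continuous_map_preimage[OF cont \<open>openin Y V\<close>] A(1) B i by (simp add: openin_Int)
    qed
    show "i = j" if "(i, z) \<in> Q" "(j, z) \<in> Q" for i j z
      using that A(3) by (auto simp: Q_def disjoint_family_on_def)
    show "x = z" if "(i, x) \<in> Q" "(i, z) \<in> Q" "f x = f z" for i x z
      using that B by (auto simp: Q_def inj_on_def)
    show "\<exists>z. (j, z) \<in> Q \<and> f z = f x" if "(i, x) \<in> Q" "j \<in> I" for i j x
      using that by (intro lift) (auto simp: Q_def)
  qed
  moreover have "V \<subseteq> O'"
    by (auto simp: V_def)
  ultimately show ?thesis
    using base \<open>w \<in> V\<close> by auto
qed

text \<open>
  The base of a maximal system is dense: near a point outside the closure of its base there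
  would be a system over a neighbourhood disjoint from the base, whose union with the maximal
  one is again a system.
\<close>
lemma sheet_system_with_dense_base_exists:
  assumes f: "local_homeomorphism_map X Y f" and "Hausdorff_space X"
    and "finite I" "I \<noteq> {}"
    and card: "\<And>w. w \<in> topspace Y \<Longrightarrow> card {y \<in> topspace X. f y = w} = card I"
  shows "\<exists>P. sheet_system X f I P \<and> Y closure_of (sheet_base f P) = topspace Y"
proof -
  have "\<exists>P\<in>{P. sheet_system X f I P}. \<forall>Q\<in>{P. sheet_system X f I P}. P \<subseteq> Q \<longrightarrow> Q = P"
    by (rule subset_Zorn') (simp add: sheet_system_Union_chain)
  then obtain P where P: "sheet_system X f I P"
    and max: "\<And>Q. sheet_system X f I Q \<Longrightarrow> P \<subseteq> Q \<Longrightarrow> Q = P"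
    by auto
  have "w \<in> Y closure_of (sheet_base f P)" if w: "w \<in> topspace Y" for w
  proof (rule ccontr)
    assume "w \<notin> Y closure_of (sheet_base f P)"
    then obtain O' where O: "openin Y O'" "w \<in> O'" "O' \<inter> sheet_base f P = {}"
      using w by (auto simp: in_closure_of disjoint_iff)
    obtain Q where Q: "sheet_system X f I Q" "w \<in> sheet_base f Q" "sheet_base f Q \<subseteq> O'"
      using small_sheet_system_exists[OF f \<open>Hausdorff_space X\<close> \<open>finite I\<close> \<open>I \<noteq> {}\<close> card[OF w] O(1,2)]
      by blast
    have "sheet_system X f I (P \<union> Q)"
      using O(3) Q(3) by (intro sheet_system_Un P Q(1)) auto
    then have "Q \<subseteq> P"
      using max[of "P \<union> Q"] by auto
    then have "w \<in> sheet_base f P"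
      using Q(2) by (auto simp: sheet_base_def)
    then show False
      using O(2,3) by auto
  qed
  then have "Y closure_of (sheet_base f P) = topspace Y"
    using closure_of_subset_topspace[of Y] by auto
  then show ?thesis
    using P by auto
qed

section \<open>The sheets and their boundaries\<close>

lemma open_map_preimage_dense:
  assumes "open_map X Y f" "Y closure_of W = topspace Y"
  shows "X closure_of {x \<in> topspace X. f x \<in> W} = topspace X"
proof -
  have "\<exists>z. z \<in> {x \<in> topspace X. f x \<in> W} \<and> z \<in> T" if T: "x \<in> T" "openin X T" for x T
  proof -
    have *: "openin Y (f ` T)"
      using assms(1) T(2) by (simp add: open_map_def)
    then have "f x \<in> Y closure_of W"
      using assms(2) T(1) openin_subset[OF *] by auto
    then obtain w where "w \<in> W" "w \<in> f ` T"
      using * T(1) unfolding in_closure_of by blast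
    then show ?thesis
      using openin_subset[OF T(2)] by blast
  qed
  then have "topspace X \<subseteq> X closure_of {x \<in> topspace X. f x \<in> W}"
    unfolding subset_iff in_closure_of by auto
  then show ?thesis
    by (rule closure_of_subset_topspace[THEN subset_antisym])
qed

theorem lemma3p1:
  fixes X :: "'a topology" and \<phi> :: "'a \<Rightarrow> 'a" and N :: nat
  assumes "compact_space X" and "Hausdorff_space X"
    and "local_homeomorphism_map X X \<phi>"
    and "N > 1"
    and "\<And>x. x \<in> topspace X \<Longrightarrow> card {y \<in> topspace X. \<phi> y = x} = N"
  shows "\<exists>U :: nat \<Rightarrow> 'a set.
      (\<forall>i\<in>{1..N}. openin X (U i)) \<and>
      disjoint_family_on U {1..N} \<and>
      (\<forall>i\<in>{1..N}. inj_on \<phi> (U i)) \<and>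
      (\<forall>i\<in>{1..N}. \<forall>j\<in>{1..N}. \<phi> ` U i = \<phi> ` U j) \<and>
      topspace X = (\<Union>i\<in>{1..N}. U i \<union> X frontier_of (U i)) \<and>
      (\<forall>i\<in>{1..N}. topspace X = \<phi> ` U i \<union> X frontier_of (\<phi> ` U i)) \<and>
      (\<forall>i\<in>{1..N}. \<phi> ` (X frontier_of (U i)) \<subseteq> X frontier_of (\<phi> ` U i)) \<and>
      (\<forall>i\<in>{1..N}. {x \<in> topspace X. \<phi> x \<in> X frontier_of (\<phi> ` U i)} =
         (\<Union>j\<in>{1..N}. X frontier_of (U j)))"
proof -
  let ?I = "{1..N}"
  have opn: "open_map X X \<phi>"
    using assms(3) unfolding local_homeomorphism_map_def by (elim conjE)
  have ne: "?I \<noteq> {}"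
    using \<open>N > 1\<close> by simp
  have fibre: "card {y \<in> topspace X. \<phi> y = x} = card ?I" if "x \<in> topspace X" for x
    using assms(5)[OF that] by simp
  obtain P where P: "sheet_system X \<phi> ?I P"
    and dense: "X closure_of (sheet_base \<phi> P) = topspace X"
    using sheet_system_with_dense_base_exists[OF assms(3,2) finite_atLeastAtMost ne fibre] by auto
  define U where "U i = P `` {i}" for i
  define W where "W = sheet_base \<phi> P"
  have U_open: "openin X (U i)" if "i \<in> ?I" for i
    using sheet_systemD(3)[OF P that] by (simp add: U_def)
  have U_disj: "disjoint_family_on U ?I"
    using sheet_systemD(4)[OF P] by (auto simp: disjoint_family_on_def U_def)
  have U_inj: "inj_on \<phi> (U i)" for i
    using sheet_systemD(5)[OF P] by (auto simp: inj_on_def U_def)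
  have U_image: "\<phi> ` U i = W" if "i \<in> ?I" for i
    using image_sheet_eq_base[OF P that] by (simp add: U_def W_def)
  have W_open: "openin X W"
  proof -
    obtain i where i: "i \<in> ?I"
      using ne by auto
    have "openin X (\<phi> ` U i)"
      using opn U_open[OF i] by (simp add: open_map_def)
    then show ?thesis
      by (simp add: U_image[OF i])
  qed
  have W_closure: "X closure_of W = topspace X"
    using dense by (simp add: W_def)
  have W_frontier: "X frontier_of W = topspace X - W"
    using W_open W_closure by (simp add: frontier_of_def interior_of_openin)
  have U_closure: "U i \<union> X frontier_of (U i) = X closure_of (U i)" if "i \<in> ?I" for i
    using closure_of_subset[OF openin_subset[OF U_open[OF that]]]
    by (auto simp: frontier_of_def interior_of_openin[OF U_open[OF that]])
  have preimage: "{x \<in> topspace X. \<phi> x \<in> W} = (\<Union>i\<in>?I. U i)"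
  proof
    show "{x \<in> topspace X. \<phi> x \<in> W} \<subseteq> (\<Union>i\<in>?I. U i)"
    proof
      fix x assume x: "x \<in> {x \<in> topspace X. \<phi> x \<in> W}"
      then have "x \<in> topspace X" "\<phi> x \<in> sheet_base \<phi> P" "\<phi> x \<in> topspace X"
        using openin_subset[OF W_open] by (auto simp: W_def)
      then have "\<exists>i\<in>?I. (i, x) \<in> P"
        by (intro sheet_system_exhausts_fibre[OF P finite_atLeastAtMost fibre])
      then show "x \<in> (\<Union>i\<in>?I. U i)"
        by (simp add: U_def)
    qed
    show "(\<Union>i\<in>?I. U i) \<subseteq> {x \<in> topspace X. \<phi> x \<in> W}"
    proof
      fix x assume "x \<in> (\<Union>i\<in>?I. U i)"
      then obtain i where i: "i \<in> ?I" "x \<in> U i"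
        by (rule UN_E)
      then have "\<phi> x \<in> W"
        using U_image[OF i(1)] by auto
      then show "x \<in> {x \<in> topspace X. \<phi> x \<in> W}"
        using openin_subset[OF U_open[OF i(1)]] i(2) by auto
    qed
  qed
  have cover: "topspace X = (\<Union>i\<in>?I. U i \<union> X frontier_of (U i))"
  proof -
    have "topspace X = X closure_of (\<Union>i\<in>?I. U i)"
      using open_map_preimage_dense[OF opn W_closure] unfolding preimage by (rule sym)
    also have "\<dots> = (\<Union>i\<in>?I. X closure_of (U i))"
      using closure_of_Union[of "U ` ?I" X] by (simp only: image_image finite_imageI finite_atLeastAtMost)
    also have "\<dots> = (\<Union>i\<in>?I. U i \<union> X frontier_of (U i))"
      by (rule SUP_cong[OF refl U_closure[symmetric]])
    finally show ?thesis .
  qed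
  have frontier_avoids: "x \<notin> U j" if "i \<in> ?I" "j \<in> ?I" "x \<in> X frontier_of (U i)" for i j x
  proof (cases "i = j")
    case True
    then show ?thesis
      using that(3) by (simp add: frontier_of_def interior_of_openin[OF U_open[OF that(2)]])
  next
    case False
    then have "U j \<inter> U i = {}"
      using disjoint_family_onD[OF U_disj that(2,1)] by simp
    then have "U j \<inter> X closure_of (U i) = {}"
      by (simp only: openin_Int_closure_of_eq_empty[OF U_open[OF that(2)]])
    then show ?thesis
      using that(3) by (auto simp: frontier_of_def)
  qed
  have frontiers: "(\<Union>j\<in>?I. X frontier_of (U j)) = {x \<in> topspace X. \<phi> x \<notin> W}"
  proof
    show "(\<Union>j\<in>?I. X frontier_of (U j)) \<subseteq> {x \<in> topspace X. \<phi> x \<notin> W}"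
    proof
      fix x assume "x \<in> (\<Union>j\<in>?I. X frontier_of (U j))"
      then obtain j where j: "j \<in> ?I" "x \<in> X frontier_of (U j)"
        by (rule UN_E)
      then have "x \<in> topspace X"
        using frontier_of_subset_topspace[of X "U j"] by auto
      moreover have "x \<notin> (\<Union>i\<in>?I. U i)"
        using frontier_avoids[OF j(1) _ j(2)] by auto
      ultimately show "x \<in> {x \<in> topspace X. \<phi> x \<notin> W}"
        using preimage by auto
    qed
    show "{x \<in> topspace X. \<phi> x \<notin> W} \<subseteq> (\<Union>j\<in>?I. X frontier_of (U j))"
    proof
      fix x assume x: "x \<in> {x \<in> topspace X. \<phi> x \<notin> W}"
      then have "x \<in> topspace X"
        by simp
      then have "x \<in> (\<Union>i\<in>?I. U i \<union> X frontier_of (U i))"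
        by (rule eqset_imp_iff[OF cover, THEN iffD1])
      then obtain j where j: "j \<in> ?I" "x \<in> U j \<union> X frontier_of (U j)"
        by (rule UN_E)
      moreover have "x \<notin> U j"
        using x U_image[OF j(1)] by auto
      ultimately show "x \<in> (\<Union>j\<in>?I. X frontier_of (U j))"
        by (intro UN_I[OF j(1)]) simp
    qed
  qed
  have maps: "\<phi> x \<in> topspace X" if "x \<in> topspace X" for x
  proof -
    have "continuous_map X X \<phi>"
      using assms(3) unfolding local_homeomorphism_map_def by (rule conjunct1)
    then show ?thesis
      using that by (rule continuous_map_image_subset_topspace[THEN subsetD, OF _ imageI])
  qed
  have W_cover: "topspace X = W \<union> X frontier_of W"
    using openin_subset[OF W_open] by (auto simp: W_frontier)
  have image_frontier: "\<phi> ` (X frontier_of (U i)) \<subseteq> X frontier_of W" if "i \<in> ?I" for i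
  proof
    fix w assume "w \<in> \<phi> ` (X frontier_of (U i))"
    then obtain x where x: "x \<in> X frontier_of (U i)" "w = \<phi> x"
      by auto
    then have "x \<in> {x \<in> topspace X. \<phi> x \<notin> W}"
      unfolding frontiers[symmetric] by (intro UN_I[OF that])
    then show "w \<in> X frontier_of W"
      using maps x(2) by (simp add: W_frontier)
  qed
  have preimage_frontier: "{x \<in> topspace X. \<phi> x \<in> X frontier_of W} = (\<Union>j\<in>?I. X frontier_of (U j))"
    unfolding frontiers W_frontier using maps by auto
  show ?thesis
  proof (intro exI[of _ U] conjI ballI)
    fix i assume i: "i \<in> ?I"
    show "openin X (U i)" "inj_on \<phi> (U i)"
      by (rule U_open[OF i], rule U_inj)
    show "\<phi> ` U i = \<phi> ` U j" if "j \<in> ?I" for j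
      unfolding U_image[OF i] U_image[OF that] ..
    show "topspace X = \<phi> ` U i \<union> X frontier_of (\<phi> ` U i)"
      unfolding U_image[OF i] by (rule W_cover)
    show "\<phi> ` (X frontier_of (U i)) \<subseteq> X frontier_of (\<phi> ` U i)"
      unfolding U_image[OF i] by (rule image_frontier[OF i])
    show "{x \<in> topspace X. \<phi> x \<in> X frontier_of (\<phi> ` U i)} = (\<Union>j\<in>?I. X frontier_of (U j))"
      unfolding U_image[OF i] by (rule preimage_frontier)
  qed (rule U_disj, rule cover)
qed

end
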